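(* For integers $m,j,n\ge 0$ let $P_{m,j}(n)$ denote the number of partitions of $n$ into $m$ distinct parts, the largest of which is $j$, together with one further part size $2m+1$ that may repeat any number of times or not appear at all. Equivalently, $P_{m,j}(n)$ is the number of pairs $(\delta,k)$ where $\delta$ is a partition into exactly $m$ distinct positive parts with largest part $j$ (with $j=0$ when $m=0$), $k\ge 0$ is an integer, and $|\delta|+k(2m+1)=n$, where $|\delta|$ is the sum of the parts of $\delta$. Then, for $0<|q|<1$, $$\sum_{m,n,j\ge0}(-1)^jP_{m,j}(n)q^n= \frac{1}{2}\sum_{n\ge0}q^{n^2+n/2}(1+q^{n+1/2})\sum_{|j|\le n}q^{j^2/2}+\frac{1}{2}\sum_{n\ge0}(-1)^nq^{n^2+n/2}(1-q^{n+1/2})\sum_{|j|\le n}(-1)^jq^{j^2/2}.$$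
   Context: Here $q\in\mathbb{C}$ with $0<|q|<1$, and $q^{1/2}$ is a fixed square root of $q$ (half-integer powers of $q$ are powers of $q^{1/2}$). On the right-hand side, $\sum_{|j|\le n}$ runs over all integers $j$ with $-n\le j\le n$; this $j$ is a dummy index unrelated to the $j$ on the left-hand side. *)

theory Defs
  imports "HOL-Analysis.Analysis"
begin

text \<open>
  A partition into distinct positive parts is encoded as the finite set of its parts.
  The empty partition has largest part 0 by convention.
\<close>

definition distinct_partition :: "nat set \<Rightarrow> bool" where
  "distinct_partition \<delta> \<longleftrightarrow> finite \<delta> \<and> (\<forall>x\<in>\<delta>. 0 < x)"

definition largest_part :: "nat set \<Rightarrow> nat" where
  "largest_part \<delta> = (if \<delta> = {} then 0 else Max \<delta>)"

text \<open>
  In a pair \<open>(\<delta>, k)\<close>, the number \<open>k\<close> is the multiplicity of the additional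
  part \<open>2 * m + 1\<close>. This part is counted separately from \<open>\<delta>\<close>, which may itself
  contain \<open>2 * m + 1\<close>.
\<close>

definition P_pairs :: "nat \<Rightarrow> nat \<Rightarrow> nat \<Rightarrow> (nat set \<times> nat) set" where
  "P_pairs m j n = {(\<delta>, k). distinct_partition \<delta> \<and> card \<delta> = m \<and> largest_part \<delta> = j \<and>
     \<Sum>\<delta> + k * (2 * m + 1) = n}"

definition P :: "nat \<Rightarrow> nat \<Rightarrow> nat \<Rightarrow> nat" where
  "P m j n = card (P_pairs m j n)"

lemma finite_P_pairs: "finite (P_pairs m j n)"
proof (rule finite_subset)
  show "P_pairs m j n \<subseteq> Pow {..n} \<times> {..n}"
  proof
    fix p assume p: "p \<in> P_pairs m j n"
    obtain \<delta> k where p_eq: "p = (\<delta>, k)" by (cases p)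
    have fin: "finite \<delta>" and eq: "\<Sum>\<delta> + k * (2 * m + 1) = n"
      using p by (auto simp: P_pairs_def distinct_partition_def p_eq)
    have "x \<le> n" if "x \<in> \<delta>" for x
      using sum.remove[OF fin that, of "\<lambda>x. x"] eq by simp
    moreover have "k \<le> n" using eq by (auto simp: algebra_simps)
    ultimately show "p \<in> Pow {..n} \<times> {..n}" by (auto simp: p_eq)
  qed
qed simp

end

theory Submission
  imports Defs
begin

text \<open>
  Write \<open>(q)\<^sub>n\<close> for the product of \<open>1 - q ^ i\<close> over \<open>1 \<le> i \<le> n\<close>.
  Subtracting 1 from every part shows that the partitions with \<open>m\<close> distinct parts, weighted by
  the parity of the largest part, have generating function
  \<open>e m = (-1) ^ m * q ^ (m * (m + 1) / 2) * (q)\<^sub>m / (q\<^sup>2; q\<^sup>2)\<^sub>m\<close>, so the left-hand side is the sum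
  of \<open>e m / (1 - q ^ (2 * m + 1))\<close>. By partial fractions this is the even part in \<open>r\<close> of the
  sum of \<open>e m / (1 - r ^ (2 * m + 1))\<close>, and the right-hand side is the even part in \<open>r\<close> of the
  sum of \<open>A n\<close>, because \<open>B\<close> arises from \<open>A\<close> by \<open>r \<mapsto> -r\<close>. That the two sums agree before taking even
  parts is an instance of Bailey's lemma relative to \<open>a = q\<close>: the Bailey pair with
  \<open>\<beta>\<^sub>m = 1 / ((q\<^sup>2; q\<^sup>2)\<^sub>m * (1 - r ^ (2 * m + 1)))\<close> is verified by summation by parts, which reduces it
  to a finite identity of Gauss, and the conjugate pair is a case of the \<open>1\<phi>1\<close> sum.
\<close>

section \<open>Finite products and a finite identity of Gauss\<close>

definition qpoch :: "'a::comm_ring_1 \<Rightarrow> nat \<Rightarrow> 'a" where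
  "qpoch q n = (\<Prod>i=1..n. 1 - q ^ i)"

lemma qpoch_0 [simp]: "qpoch q 0 = 1"
  by (simp add: qpoch_def)

lemma qpoch_Suc: "qpoch q (Suc n) = qpoch q n * (1 - q ^ Suc n)"
  by (simp add: qpoch_def)

lemma qpoch_nonzero:
  fixes q :: "'a::field"
  assumes "\<forall>i>0. q ^ i \<noteq> 1"
  shows "qpoch q n \<noteq> 0"
  using assms by (auto simp: qpoch_def)

text \<open>Each summand is that of (1 - q^(2n+2)) Gamma(n+1) - Gamma(n), where Gamma(n) is the sum
  in \<open>finite_gauss_identity\<close>. It is a difference in s, so its partial sums have a
  closed form that induction on k confirms. The weights 1 and 2 fold a symmetric sum over -k <= s <=
  k.\<close>

lemma finite_gauss_partial_sum:
  fixes q :: "'a::field"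
  assumes q: "\<forall>i>0. q ^ i \<noteq> 1" and "k \<le> n"
  shows "(\<Sum>s\<le>k. (if s = 0 then 1 else 2) * ((-1) ^ s * q ^ (s ^ 2)) *
           ((1 - q ^ (2 * n + 2)) / (qpoch q (Suc n - s) * qpoch q (Suc n + s))
             - 1 / (qpoch q (n - s) * qpoch q (n + s)))) =
         2 * (-1) ^ k * q ^ (k ^ 2 + n + 1 + k) / (qpoch q (n - k) * qpoch q (Suc n + k))"
  using \<open>k \<le> n\<close>
proof (induction k)
  case 0
  define b where "b = q ^ Suc n"
  have b: "1 - b \<noteq> 0" using q[rule_format, of "Suc n"] by (simp add: b_def)
  have B: "qpoch q n \<noteq> 0" using q by (rule qpoch_nonzero)
  have "q ^ (2 * n + 2) = b * b" by (simp add: b_def power_add mult_2)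
  then have "1 - q ^ (2 * n + 2) = (1 - b) * (1 + b)" by (simp add: algebra_simps)
  moreover have "qpoch q (Suc n) = qpoch q n * (1 - b)" "q ^ (0\<^sup>2 + n + 1 + 0) = b"
    by (simp_all add: b_def qpoch_Suc)
  ultimately have e: "1 - q ^ (2 * n + 2) = (1 - b) * (1 + b)" "qpoch q (Suc n) = qpoch q n * (1 - b)"
      "q ^ (0\<^sup>2 + n + 1 + 0) = b" .
  have "a * (1 + b) / (qpoch q n * a * (qpoch q n * a)) - 1 / (qpoch q n * qpoch q n)
      = ((1 + b) - a) / (qpoch q n * (qpoch q n * a))" if "a \<noteq> 0" for a
    using that B by (simp add: field_simps)
  from this[OF b] have "(1 - b) * (1 + b) / (qpoch q n * (1 - b) * (qpoch q n * (1 - b))) - 1 / (qpoch q n * qpoch q n)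
      = 2 * b / (qpoch q n * (qpoch q n * (1 - b)))"
    by simp
  with e show ?case by simp
next
  case (Suc k)
  \<comment> \<open>With n = k + 1 + d every power becomes a monomial in q, x, y and z, so the
    induction step turns into an identity of rational functions.\<close>
  obtain d where n: "n = Suc k + d" using Suc.prems le_Suc_ex by blast
  define x where "x = q ^ k"
  define y where "y = q ^ d"
  define z where "z = q ^ (k ^ 2)"
  have nz: "1 - q ^ Suc d \<noteq> 0" "1 - q ^ Suc (Suc (2 * k + d)) \<noteq> 0"
     "1 - q ^ Suc (Suc (Suc (2 * k + d))) \<noteq> 0"
    using q[rule_format, of "Suc d"] q[rule_format, of "Suc (Suc (2 * k + d))"] q[rule_format, of "Suc (Suc (Suc (2 * k + d)))"] by auto
  have nz': "qpoch q d \<noteq> 0" "qpoch q (Suc (2 * k + d)) \<noteq> 0"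
    using qpoch_nonzero[OF q] by auto
  have e: "Suc n - Suc k = Suc d" "n - Suc k = d" "n - k = Suc d"
     "Suc n + Suc k = Suc (Suc (Suc (2 * k + d)))" "n + Suc k = Suc (Suc (2 * k + d))"
     "Suc n + k = Suc (Suc (2 * k + d))"
    by (auto simp: n)
  have p: "q ^ Suc d = q * y" "q ^ Suc (Suc (2 * k + d)) = q ^ 2 * x ^ 2 * y"
     "q ^ Suc (Suc (Suc (2 * k + d))) = q ^ 3 * x ^ 2 * y"
     "q ^ (2 * n + 2) = q ^ 4 * x ^ 2 * y ^ 2"
     "q ^ (Suc k)\<^sup>2 = z * x ^ 2 * q"
     "q ^ (k\<^sup>2 + n + 1 + k) = z * x ^ 2 * y * q ^ 2"
     "q ^ ((Suc k)\<^sup>2 + n + 1 + Suc k) = z * x ^ 4 * y * q ^ 4"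
    by (simp_all add: n x_def y_def z_def power_add power_mult power2_eq_square mult_2 eval_nat_numeral)
  have "(\<Sum>s\<le>k. (if s = 0 then 1 else 2) * ((-1) ^ s * q ^ (s ^ 2)) *
           ((1 - q ^ (2 * n + 2)) / (qpoch q (Suc n - s) * qpoch q (Suc n + s))
             - 1 / (qpoch q (n - s) * qpoch q (n + s)))) =
         2 * (-1) ^ k * q ^ (k ^ 2 + n + 1 + k) / (qpoch q (n - k) * qpoch q (Suc n + k))"
    using Suc by simp
  moreover have "2 * (-1) ^ k * q ^ (k ^ 2 + n + 1 + k) / (qpoch q (n - k) * qpoch q (Suc n + k)) +
     2 * ((-1) ^ Suc k * q ^ ((Suc k) ^ 2)) *
           ((1 - q ^ (2 * n + 2)) / (qpoch q (Suc n - Suc k) * qpoch q (Suc n + Suc k))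
             - 1 / (qpoch q (n - Suc k) * qpoch q (n + Suc k))) =
     2 * (-1) ^ Suc k * q ^ ((Suc k) ^ 2 + n + 1 + Suc k) / (qpoch q (n - Suc k) * qpoch q (Suc n + Suc k))"
  proof -
    have "2 * u * (z * x ^ 2 * y * q ^ 2) / (A * a * (B * b)) + 2 * (- u * (z * x ^ 2 * q)) *
        ((1 - q ^ 4 * x ^ 2 * y ^ 2) / (A * a * (B * b * c)) - 1 / (A * (B * b))) =
        2 * (- u) * (z * x ^ 4 * y * q ^ 4) / (A * (B * b * c))"
      if "a = 1 - q * y" "c = 1 - q ^ 3 * x ^ 2 * y" and nz: "a \<noteq> 0" "b \<noteq> 0" "c \<noteq> 0" "A \<noteq> 0" "B \<noteq> 0"
      for a b c A B u
    proof -
      \<comment> \<open>Here a = 1 - q^(n-k) and c = 1 - q^(n+k+2). The product a * c cancels the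
        subtracted fraction, the term y * q * c cancels the value for k, and the last term leaves
        the value for k + 1.\<close>
      have D: "1 - q ^ 4 * x ^ 2 * y ^ 2 = y * q * c + a * c + x ^ 2 * y * q ^ 3 * a"
        by (simp add: that(1,2) algebra_simps eval_nat_numeral)
      have p: "x ^ 4 = x ^ 2 * x ^ 2" "q ^ 4 = q * q ^ 3" for x :: 'a
        by (simp_all add: eval_nat_numeral)
      have D': "(1 - q ^ 4 * x ^ 2 * y ^ 2) / (A * a * (B * b * c)) - 1 / (A * (B * b))
          = (y * q) / (A * a * (B * b)) + x ^ 2 * y * q ^ 3 / (A * (B * b * c))"
        unfolding D add_divide_distrib using nz by (simp add: mult_ac)
      show ?thesis
        unfolding D' using nz by (simp add: p power2_eq_square power3_eq_cube distrib_left distrib_right mult_ac)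
    qed
    note gen = this
    have "qpoch q (Suc (Suc (2 * k + d))) = qpoch q (Suc (2 * k + d)) * (1 - q ^ Suc (Suc (2 * k + d)))"
      "qpoch q (Suc (Suc (Suc (2 * k + d)))) = qpoch q (Suc (2 * k + d)) * (1 - q ^ Suc (Suc (2 * k + d))) * (1 - q ^ Suc (Suc (Suc (2 * k + d))))"
      "qpoch q (Suc d) = qpoch q d * (1 - q ^ Suc d)" "(-1) ^ Suc k = - ((-1) ^ k :: 'a)"
      by (simp_all only: qpoch_Suc) simp
    note e = e this
    show ?thesis
      unfolding e using gen[OF _ _ nz(1,2,3) nz', of "(-1) ^ k"] unfolding p by blast
  qed
  ultimately show ?case
    unfolding sum.atMost_Suc by simp
qed

text \<open>Multiplied by (q)_(2n), this is Gauss's alternating sum of q-binomial coefficients with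
  q replaced by 1/q. The partial sum at k = n is the negative of the top summand s = n + 1, whence
  (1 - q^(2n+2)) Gamma(n+1) = Gamma(n).\<close>

lemma finite_gauss_identity:
  fixes q :: "'a::field"
  assumes q: "\<forall>i>0. q ^ i \<noteq> 1"
  shows "(\<Sum>s\<le>n. (if s = 0 then 1 else 2) * ((-1) ^ s * q ^ (s ^ 2)) / (qpoch q (n - s) * qpoch q (n + s)))
         = 1 / qpoch (q ^ 2) n"
proof (induction n)
  case (Suc n)
  let ?w = "\<lambda>s. (if s = 0 then 1 else 2) * ((-1) ^ s * q ^ (s ^ 2)) :: 'a"
  let ?\<Gamma> = "\<lambda>n. \<Sum>s\<le>n. ?w s / (qpoch q (n - s) * qpoch q (n + s))"
  have nz: "1 - q ^ (2 * n + 2) \<noteq> 0" using q[rule_format, of "2 * n + 2"] by simp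
  have nz': "qpoch q (Suc n + n) \<noteq> 0" using q by (rule qpoch_nonzero)
  have "(1 - q ^ (2 * n + 2)) * (\<Sum>s\<le>n. ?w s / (qpoch q (Suc n - s) * qpoch q (Suc n + s))) - ?\<Gamma> n =
      (\<Sum>s\<le>n. ?w s * ((1 - q ^ (2 * n + 2)) / (qpoch q (Suc n - s) * qpoch q (Suc n + s))
             - 1 / (qpoch q (n - s) * qpoch q (n + s))))"
    by (simp add: sum_distrib_left sum_subtractf algebra_simps)
  also have "\<dots> = 2 * (-1) ^ n * q ^ (n ^ 2 + n + 1 + n) / qpoch q (Suc n + n)"
    using finite_gauss_partial_sum[OF q, of n n] by simp
  finally have A: "(1 - q ^ (2 * n + 2)) * (\<Sum>s\<le>n. ?w s / (qpoch q (Suc n - s) * qpoch q (Suc n + s))) - ?\<Gamma> n =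
     2 * (-1) ^ n * q ^ (n ^ 2 + n + 1 + n) / qpoch q (Suc n + n)" .
  have e: "Suc n + Suc n = Suc (Suc n + n)" "q ^ Suc (Suc n + n) = q ^ (2 * n + 2)" by (auto simp: mult_2)
  \<comment> \<open>The factor 1 - q^(2n+2) is the last factor of (q)_(2n+2), and (n+1)^2 = n^2 + n
    + 1 + n, so this cancels the right-hand side of \<open>A\<close>.\<close>
  have B: "(1 - q ^ (2 * n + 2)) * (?w (Suc n) / (qpoch q (Suc n - Suc n) * qpoch q (Suc n + Suc n))) =
    - 2 * (-1) ^ n * q ^ (n ^ 2 + n + 1 + n) / qpoch q (Suc n + n)"
    using nz nz' unfolding e(1) qpoch_Suc e(2)
    by (simp add: power2_eq_square) (simp add: mult_2 add_ac)
  have "(1 - q ^ (2 * n + 2)) * ?\<Gamma> (Suc n) = ?\<Gamma> n"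
    using A unfolding sum.atMost_Suc[of _ n] distrib_left B
    by (simp only: diff_eq_eq) simp
  then have "?\<Gamma> (Suc n) = ?\<Gamma> n / (1 - q ^ (2 * n + 2))"
    using nz by (simp add: field_simps)
  also have "\<dots> = 1 / qpoch (q ^ 2) (Suc n)"
  proof -
    have "(q ^ 2) ^ Suc n = q ^ (2 * n + 2)"
      by (metis add_2_eq_Suc' mult_Suc_right power_mult add.commute)
    then show ?thesis unfolding Suc.IH qpoch_Suc by simp
  qed
  finally show ?case .
qed simp

section \<open>The Bailey pair\<close>

definition theta_sum :: "complex \<Rightarrow> nat \<Rightarrow> complex" where
  "theta_sum r n = (\<Sum>j\<in>{- int n..int n}. r powi (j ^ 2))"

lemma theta_sum_0 [simp]: "theta_sum r 0 = 1"
  by (simp add: theta_sum_def)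

lemma theta_sum_Suc: "theta_sum r (Suc n) = theta_sum r n + 2 * r ^ ((Suc n) ^ 2)"
proof -
  have "{- int (Suc n)..int (Suc n)} = insert (- int (Suc n)) (insert (int (Suc n)) {- int n..int n})"
    by auto
  moreover have "r powi ((int (Suc n)) ^ 2) = r ^ ((Suc n) ^ 2)"
    by (metis of_nat_power power_int_of_nat)
  ultimately show ?thesis
    by (simp add: theta_sum_def del: of_nat_Suc)
qed

text \<open>The numerator splits as (1 - r^(2n+1)) (1 + r^(2k+1)) = (1 - r^(2(n+k+1))) + r^(2k+1) (1
  - r^(2(n-k))), and each bracket cancels the last factor of one of the two products. The assumption
  k < n keeps n - (k+1) a true subtraction.\<close>

lemma bailey_term_telescope:
  fixes r :: complex
  assumes q: "\<forall>i>0. (r ^ 2) ^ i \<noteq> 1" and "k < n"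
  shows "(1 - r ^ (2 * n + 1)) * (r ^ (k ^ 2) * (1 + r ^ (2 * k + 1))) / (qpoch (r ^ 2) (n - k) * qpoch (r ^ 2) (n + k + 1))
       = r ^ (k ^ 2) / (qpoch (r ^ 2) (n - k) * qpoch (r ^ 2) (n + k))
         + r ^ ((Suc k) ^ 2) / (qpoch (r ^ 2) (n - Suc k) * qpoch (r ^ 2) (n + Suc k))"
proof -
  obtain d where n: "n = Suc k + d" using assms(2) less_iff_Suc_add by auto
  define x where "x = r ^ k"
  define y where "y = r ^ d"
  define z where "z = r ^ (k ^ 2)"
  have nz: "1 - (r^2) ^ Suc d \<noteq> 0" "1 - (r^2) ^ Suc (Suc (2 * k + d)) \<noteq> 0"
    using q[rule_format, of "Suc d"] q[rule_format, of "Suc (Suc (2 * k + d))"] by auto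
  have nz': "qpoch (r^2) d \<noteq> 0" "qpoch (r^2) (Suc (2 * k + d)) \<noteq> 0"
    using qpoch_nonzero[OF q] by auto
  have e: "n - Suc k = d" "n - k = Suc d"
     "n + k + 1 = Suc (Suc (2 * k + d))" "n + Suc k = Suc (Suc (2 * k + d))"
     "n + k = Suc (2 * k + d)" "Suc (2 * k + d) + 1 = Suc (Suc (2 * k + d))"
    by (auto simp: n)
  have p: "(r^2) ^ Suc d = r^2 * y^2" "(r^2) ^ Suc (Suc (2 * k + d)) = r ^ 4 * x ^ 4 * y^2"
     "r ^ (2 * n + 1) = r ^ 3 * x ^ 2 * y ^ 2"
     "r ^ (2 * k + 1) = r * x ^ 2"
     "r ^ (Suc k)\<^sup>2 = z * x ^ 2 * r"
    by (simp_all add: n x_def y_def z_def power_add power_mult power2_eq_square mult_2 eval_nat_numeral power_mult_distrib)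
  have *: "qpoch (r^2) (Suc (Suc (2*k+d))) = qpoch (r^2) (Suc (2*k+d)) * (1 - (r^2) ^ Suc (Suc (2 * k + d)))"
    "qpoch (r^2) (Suc d) = qpoch (r^2) d * (1 - (r^2) ^ Suc d)"
    by (rule qpoch_Suc)+
  have "(1 - r ^ 3 * x\<^sup>2 * y\<^sup>2) * (z * (1 + r * x\<^sup>2)) / (A * a * (B * b)) =
      z / (A * a * B) + z * x\<^sup>2 * r / (A * (B * b))"
    if "a = 1 - r\<^sup>2 * y\<^sup>2" "b = 1 - r ^ 4 * x ^ 4 * y\<^sup>2" "a \<noteq> 0" "b \<noteq> 0" "A \<noteq> 0" "B \<noteq> 0" for a b A B
  proof -
    have "(1 - r ^ 3 * x\<^sup>2 * y\<^sup>2) * (1 + r * x\<^sup>2) = b + r * x\<^sup>2 * a"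
      by (simp add: that(1,2) algebra_simps eval_nat_numeral)
    then have "(1 - r ^ 3 * x\<^sup>2 * y\<^sup>2) * (z * (1 + r * x\<^sup>2)) = z * (b + r * x\<^sup>2 * a)"
      by simp
    then show ?thesis
      using that(3-) by (simp only:) (simp add: divide_simps, simp add: algebra_simps)
  qed
  from this[OF refl refl] show ?thesis
    using nz nz' unfolding e * p z_def[symmetric] by blast
qed

text \<open>Summation by parts. Put g(s) = r^(s^2) / ((q)_(n-s) (q)_(n+s)) with q = r^2; the summand
  is (-1)^s \<open>theta_sum r s\<close> (g(s) + g(s+1)). The increment 2 r^(s^2) of
  \<open>theta_sum\<close> times the r^(s^2) in g(s) yields the summand of Gauss's identity, and a
  boundary term at k remains.\<close>

lemma bailey_partial_sum:
  fixes r :: complex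
  assumes q: "\<forall>i>0. (r ^ 2) ^ i \<noteq> 1" and "k \<le> n"
  shows "(1 - r ^ (2 * n + 1)) *
     (\<Sum>s<k. (-1) ^ s * r ^ (s ^ 2) * (1 + r ^ (2 * s + 1)) * theta_sum r s / (qpoch (r ^ 2) (n - s) * qpoch (r ^ 2) (n + s + 1)))
   = (\<Sum>s\<le>k. (if s = 0 then 1 else 2) * ((-1) ^ s * (r ^ 2) ^ (s ^ 2)) / (qpoch (r ^ 2) (n - s) * qpoch (r ^ 2) (n + s)))
     - (-1) ^ k * theta_sum r k * r ^ (k ^ 2) / (qpoch (r ^ 2) (n - k) * qpoch (r ^ 2) (n + k))"
  using \<open>k \<le> n\<close>
proof (induction k)
  case (Suc k)
  let ?L = "\<lambda>k. (\<Sum>s<k. (-1) ^ s * r ^ (s ^ 2) * (1 + r ^ (2 * s + 1)) * theta_sum r s / (qpoch (r ^ 2) (n - s) * qpoch (r ^ 2) (n + s + 1)))"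
  have sq: "(r ^ 2) ^ (m ^ 2) = r ^ (m ^ 2) * r ^ (m ^ 2)" for m
    by (simp add: power2_eq_square power_mult_distrib)
  let ?u = "(r ^ (k ^ 2) * (1 + r ^ (2 * k + 1))) / (qpoch (r ^ 2) (n - k) * qpoch (r ^ 2) (n + k + 1))"
  let ?R = "\<lambda>k. (\<Sum>s\<le>k. (if s = 0 then 1 else 2) * ((-1) ^ s * (r ^ 2) ^ (s ^ 2)) / (qpoch (r ^ 2) (n - s) * qpoch (r ^ 2) (n + s)))"
  let ?D = "\<lambda>k. qpoch (r ^ 2) (n - k) * qpoch (r ^ 2) (n + k)"
  have "(1 - r ^ (2 * n + 1)) * ?L (Suc k) = (1 - r ^ (2 * n + 1)) * ?L k + (-1) ^ k * theta_sum r k *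
     ((1 - r ^ (2 * n + 1)) * (r ^ (k ^ 2) * (1 + r ^ (2 * k + 1))) / (qpoch (r ^ 2) (n - k) * qpoch (r ^ 2) (n + k + 1)))"
    by (simp add: distrib_left mult_ac)
  also have "\<dots> = (?R k - (-1) ^ k * theta_sum r k * r ^ (k ^ 2) / ?D k)
     + (-1) ^ k * theta_sum r k * (r ^ (k ^ 2) / ?D k + r ^ ((Suc k) ^ 2) / ?D (Suc k))"
    unfolding bailey_term_telescope[OF q Suc_le_lessD[OF Suc.prems]] Suc.IH[OF Suc_leD[OF Suc.prems]] ..
  also have "\<dots> = ?R k + (-1) ^ k * theta_sum r k * r ^ ((Suc k) ^ 2) / ?D (Suc k)"
    by (simp add: distrib_left)
  also have "\<dots> = ?R (Suc k) - (-1) ^ Suc k * theta_sum r (Suc k) * r ^ ((Suc k) ^ 2) / ?D (Suc k)"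
    unfolding sum.atMost_Suc theta_sum_Suc sq[rule_format, of "Suc k"]
    by (simp add: ring_distribs add_divide_distrib diff_divide_distrib mult_ac)
  finally show ?case .
qed simp

text \<open>Up to the factor 1 - q, this is the defining relation of a Bailey pair relative to q =
  r^2. The summand s = n lies outside the telescoping range and cancels the boundary term of
  \<open>bailey_partial_sum\<close> at k = n.\<close>

lemma bailey_pair:
  fixes r :: complex
  assumes q: "\<forall>i>0. (r ^ 2) ^ i \<noteq> 1"
  shows "(1 - r ^ (2 * n + 1)) *
     (\<Sum>s\<le>n. (-1) ^ s * r ^ (s ^ 2) * (1 + r ^ (2 * s + 1)) * theta_sum r s / (qpoch (r ^ 2) (n - s) * qpoch (r ^ 2) (n + s + 1)))
   = 1 / qpoch ((r ^ 2) ^ 2) n"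
proof -
  let ?f = "\<lambda>s. (-1) ^ s * r ^ (s ^ 2) * (1 + r ^ (2 * s + 1)) * theta_sum r s / (qpoch (r ^ 2) (n - s) * qpoch (r ^ 2) (n + s + 1))"
  \<comment> \<open>The last factor 1 - r^(4n+2) of (q)_(2n+1) is a difference of squares; its two
    factors are exactly those in the summand s = n.\<close>
  have e: "qpoch (r ^ 2) (n + n + 1) = qpoch (r ^ 2) (n + n) * ((1 - r ^ (2 * n + 1)) * (1 + r ^ (2 * n + 1)))"
  proof -
    have "(r ^ 2) ^ Suc (n + n) = r ^ (2 * n + 1) * r ^ (2 * n + 1)"
      by (simp flip: power_add power_mult add: mult_2)
    then show ?thesis by (simp add: qpoch_Suc algebra_simps)
  qed
  have "qpoch (r ^ 2) (n + n + 1) \<noteq> 0" by (rule qpoch_nonzero[OF q])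
  then have "(1 - r ^ (2 * n + 1)) * ?f n = (-1) ^ n * theta_sum r n * r ^ (n ^ 2) / (qpoch (r ^ 2) (n - n) * qpoch (r ^ 2) (n + n))"
    unfolding e by (simp add: divide_simps)
  moreover have "(1 - r ^ (2 * n + 1)) * (\<Sum>s<n. ?f s) =
      1 / qpoch ((r ^ 2) ^ 2) n - (-1) ^ n * theta_sum r n * r ^ (n ^ 2) / (qpoch (r ^ 2) (n - n) * qpoch (r ^ 2) (n + n))"
    unfolding bailey_partial_sum[OF q order_refl] finite_gauss_identity[OF q] ..
  ultimately show ?thesis
    unfolding lessThan_Suc_atMost[symmetric] sum.lessThan_Suc distrib_left by simp
qed

section \<open>Bounds uniform in the index, for absolute convergence\<close>

lemma power_neq_1:
  fixes q :: complex
  assumes "norm q < 1"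
  shows "\<forall>i>0. q ^ i \<noteq> 1"
proof (intro allI impI notI)
  fix i :: nat assume "0 < i" "q ^ i = 1"
  then have "norm q ^ i = 1" by (metis norm_one norm_power)
  with \<open>0 < i\<close> assms show False
    by (metis norm_ge_zero less_irrefl power_less_one_iff)
qed

lemma sum_power_le:
  fixes x :: real
  assumes "0 \<le> x" "x < 1"
  shows "(\<Sum>i=1..n. x ^ i) \<le> 1 / (1 - x)"
proof -
  have "(\<Sum>i=1..n. x ^ i) \<le> (\<Sum>i. x ^ i)"
    by (rule sum_le_suminf) (use assms in auto)
  with assms show ?thesis by (simp add: suminf_geometric)
qed

lemma norm_qpoch_bounded:
  fixes q :: complex
  assumes "norm q < 1"
  shows "norm (qpoch q n) \<le> exp (1 / (1 - norm q))"
proof -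
  have "norm (qpoch q n) = (\<Prod>i=1..n. norm (1 - q ^ i))"
    by (simp add: qpoch_def prod_norm)
  also have "\<dots> \<le> (\<Prod>i=1..n. exp (norm q ^ i))"
  proof (rule prod_mono, safe)
    fix i
    have "norm (1 - q ^ i) \<le> 1 + norm q ^ i"
      using norm_triangle_ineq4[of 1 "q ^ i"] by (simp add: norm_power)
    also have "\<dots> \<le> exp (norm q ^ i)" by (rule exp_ge_add_one_self)
    finally show "norm (1 - q ^ i) \<le> exp (norm q ^ i)" .
  qed simp
  also have "\<dots> = exp (\<Sum>i=1..n. norm q ^ i)" by (simp add: exp_sum)
  also have "\<dots> \<le> exp (1 / (1 - norm q))" using sum_power_le assms by simp
  finally show ?thesis .
qed

lemma norm_inverse_qpoch_bounded:
  fixes q :: complex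
  assumes "norm q < 1"
  shows "norm (inverse (qpoch q n)) \<le> exp (1 / (1 - norm q) ^ 2)"
proof -
  let ?x = "norm q"
  have "norm (inverse (qpoch q n)) = (\<Prod>i=1..n. inverse (norm (1 - q ^ i)))"
    by (simp add: qpoch_def prod_norm[symmetric] norm_inverse prod_inversef[symmetric] o_def)
  also have "\<dots> \<le> (\<Prod>i=1..n. exp (?x ^ i / (1 - ?x)))"
  proof (rule prod_mono, intro conjI)
    fix i assume "i \<in> {1..n}"
    then have xi: "?x ^ i \<le> ?x" using assms power_decreasing[of 1 i ?x] by simp
    have "1 - ?x ^ i \<le> norm (1 - q ^ i)"
      using norm_triangle_ineq2[of 1 "q ^ i"] by (simp add: norm_power)
    then have "inverse (norm (1 - q ^ i)) \<le> inverse (1 - ?x ^ i)"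
      by (rule le_imp_inverse_le) (use xi assms in simp)
    also have "\<dots> = 1 + ?x ^ i / (1 - ?x ^ i)" using xi assms by (simp add: field_simps)
    also have "\<dots> \<le> 1 + ?x ^ i / (1 - ?x)" using xi assms by (simp add: frac_le)
    also have "\<dots> \<le> exp (?x ^ i / (1 - ?x))" by (rule exp_ge_add_one_self)
    finally show "inverse (norm (1 - q ^ i)) \<le> exp (?x ^ i / (1 - ?x))" .
  qed simp
  also have "\<dots> = exp ((\<Sum>i=1..n. ?x ^ i) / (1 - ?x))" by (simp add: exp_sum sum_divide_distrib)
  also have "\<dots> \<le> exp (1 / (1 - ?x) ^ 2)"
    using divide_right_mono[OF sum_power_le[of ?x n], of "1 - ?x"] assms by (simp add: power2_eq_square)
  finally show ?thesis .
qed

lemma norm_theta_sum_bounded: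
  assumes "norm r < 1"
  shows "norm (theta_sum r n) \<le> 1 + 2 / (1 - norm r)"
proof -
  have "theta_sum r n = 1 + 2 * (\<Sum>j=1..n. r ^ (j ^ 2))"
    by (induction n) (simp_all add: theta_sum_Suc algebra_simps)
  then have "norm (theta_sum r n) \<le> 1 + 2 * (\<Sum>j=1..n. norm r ^ (j ^ 2))"
    using norm_triangle_ineq[of 1 "2 * (\<Sum>j=1..n. r ^ (j ^ 2))"] norm_sum[of "\<lambda>j. r ^ (j ^ 2)" "{1..n}"]
    by (simp add: norm_mult norm_power)
  also have "(\<Sum>j=1..n. norm r ^ (j ^ 2)) \<le> (\<Sum>j=1..n. norm r ^ j)"
    by (intro sum_mono power_decreasing) (use assms in \<open>auto simp: power2_eq_square\<close>)
  also have "\<dots> \<le> 1 / (1 - norm r)" using assms sum_power_le[of "norm r" n] by simp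
  finally show ?thesis by simp
qed

section \<open>Triangular numbers and the \<open>1\<phi>1\<close> sum\<close>

definition tri :: "nat \<Rightarrow> nat" where "tri n = \<Sum>{..n}"

lemma tri_0 [simp]: "tri 0 = 0"
  and tri_Suc [simp]: "tri (Suc n) = tri n + Suc n"
  by (simp_all add: tri_def)

lemma le_tri: "n \<le> tri n"
  by (induction n) auto

lemma tri_add: "tri (m + n) = tri m + tri n + m * n"
  by (induction n) auto

lemma two_tri: "2 * tri n = n ^ 2 + n"
  by (induction n) (auto simp: power2_eq_square)

text \<open>The \<open>1\<phi>1\<close> sum with parameters \<open>a = q ^ (s + 1)\<close>, \<open>c = q ^ (s + u + 2)\<close>; it telescopes for \<open>s = 0\<close>.\<close>

lemma phi11_sum:
  fixes q :: complex
  assumes "norm q < 1"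
  shows "(\<lambda>t. (-1) ^ t * q ^ (tri t + u * t) * qpoch q (s + t) / (qpoch q t * qpoch q (s + u + 1 + t)))
           sums (qpoch q s / qpoch q u)"
proof (induction s arbitrary: u)
  case 0
  have nz: "qpoch q n \<noteq> 0" for n using power_neq_1[OF assms] by (rule qpoch_nonzero)
  \<comment> \<open>For s = 0 the factor (q)_t cancels. Writing 1 = (1 - q^(u+t+1)) + q^(u+t+1)
    splits the summand into G(t) - G(t+1), since the exponent of q in G grows by u + t + 1.\<close>
  define G where "G t = (-1) ^ t * q ^ (tri t + u * t) / qpoch q (u + t)" for t
  have "G \<longlonglongrightarrow> 0"
  proof (rule Lim_null_comparison)
    show "\<forall>\<^sub>F t in sequentially. norm (G t) \<le> exp (1 / (1 - norm q) ^ 2) * norm q ^ t"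
    proof (rule always_eventually, rule allI)
      fix t
      have "norm (G t) = norm (inverse (qpoch q (u + t))) * norm q ^ (tri t + u * t)"
        by (simp add: G_def norm_mult norm_power norm_divide norm_inverse field_simps)
      also have "\<dots> \<le> exp (1 / (1 - norm q) ^ 2) * norm q ^ t"
        by (intro mult_mono norm_inverse_qpoch_bounded power_decreasing)
           (use assms le_tri[of t] in auto)
      finally show "norm (G t) \<le> exp (1 / (1 - norm q) ^ 2) * norm q ^ t" .
    qed
    show "(\<lambda>t. exp (1 / (1 - norm q) ^ 2) * norm q ^ t) \<longlonglongrightarrow> 0"
      using assms by (intro tendsto_mult_right_zero LIMSEQ_power_zero) simp
  qed
  then have "(\<lambda>t. G t - G (Suc t)) sums (G 0 - 0)" by (rule telescope_sums')
  moreover have "G t - G (Suc t) = (-1) ^ t * q ^ (tri t + u * t) * qpoch q (0 + t) / (qpoch q t * qpoch q (0 + u + 1 + t))" for t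
  proof -
    let ?c = "(-1) ^ t * q ^ (tri t + u * t)"
    have Q: "qpoch q (Suc (u + t)) = qpoch q (u + t) * (1 - q ^ Suc (u + t))" by (rule qpoch_Suc)
    have nz': "1 - q ^ Suc (u + t) \<noteq> 0" using nz[of "Suc (u + t)"] unfolding Q by auto
    have "G t = ?c * (1 - q ^ Suc (u + t)) / qpoch q (Suc (u + t))"
      unfolding G_def Q using nz' by simp
    moreover have "G (Suc t) = - (?c * q ^ Suc (u + t)) / qpoch q (Suc (u + t))"
      unfolding G_def by (simp add: power_add mult_ac)
    ultimately have "G t - G (Suc t) = ?c / qpoch q (Suc (u + t))"
      by (simp add: diff_divide_distrib[symmetric] add_divide_distrib[symmetric] right_diff_distrib del: power_Suc)
    also have "\<dots> = ?c * qpoch q (0 + t) / (qpoch q t * qpoch q (0 + u + 1 + t))" using nz[of t] by simp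
    finally show ?thesis .
  qed
  ultimately show ?case by (simp add: G_def)
next
  case (Suc s)
  have nz: "qpoch q n \<noteq> 0" for n using power_neq_1[OF assms] by (rule qpoch_nonzero)
  let ?f = "\<lambda>s u t. (-1) ^ t * q ^ (tri t + u * t) * qpoch q (s + t) / (qpoch q t * qpoch q (s + u + 1 + t))"
  \<comment> \<open>A contiguous relation raises s at the cost of also using u + 1, which is why u
    is arbitrary in the induction. Over the common denominator (q)_(s+u+t+2) the numerators combine
    to 1 - q^(s+t+1).\<close>
  have "(\<lambda>t. ?f s u t - q ^ Suc s * (1 - q ^ Suc u) * ?f s (Suc u) t) sums
     (qpoch q s / qpoch q u - q ^ Suc s * (1 - q ^ Suc u) * (qpoch q s / qpoch q (Suc u)))"
    by (intro sums_diff sums_mult Suc)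
  moreover have "?f s u t - q ^ Suc s * (1 - q ^ Suc u) * ?f s (Suc u) t = ?f (Suc s) u t" for t
  proof -
    let ?N = "s + u + 1 + t"
    let ?c = "(-1) ^ t * q ^ (tri t + u * t) * qpoch q (s + t) / qpoch q t"
    have Q: "qpoch q (Suc ?N) = qpoch q ?N * (1 - q ^ Suc ?N)" by (rule qpoch_Suc)
    have nz': "1 - q ^ Suc ?N \<noteq> 0" using nz[of "Suc ?N"] unfolding Q by auto
    have 1: "?f s u t = ?c * (1 - q ^ Suc ?N) / qpoch q (Suc ?N)"
      unfolding Q using nz' by simp
    have 2: "?f s (Suc u) t = ?c * q ^ t / qpoch q (Suc ?N)"
      by (simp add: power_add mult_ac)
    have 3: "?f (Suc s) u t = ?c * (1 - q ^ Suc (s + t)) / qpoch q (Suc ?N)"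
      by (simp add: qpoch_Suc mult_ac)
    have "1 - q ^ Suc ?N - q ^ Suc s * (1 - q ^ Suc u) * q ^ t = 1 - q ^ Suc (s + t)"
      by (simp add: algebra_simps power_add)
    moreover have "c * x / D - w * (c * y / D) = c * z / D" if "x - w * y = z" for c w x y z D :: complex
      by (simp add: that[symmetric] right_diff_distrib diff_divide_distrib mult.left_commute)
    ultimately have "?c * (1 - q ^ Suc ?N) / qpoch q (Suc ?N) - q ^ Suc s * (1 - q ^ Suc u) * (?c * q ^ t / qpoch q (Suc ?N))
       = ?c * (1 - q ^ Suc (s + t)) / qpoch q (Suc ?N)"
      by blast
    then show ?thesis unfolding 1 2 3 .
  qed
  moreover have "qpoch q s / qpoch q u - q ^ Suc s * (1 - q ^ Suc u) * (qpoch q s / qpoch q (Suc u)) = qpoch q (Suc s) / qpoch q u"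
  proof -
    have "1 - q ^ Suc u \<noteq> 0" using nz[of "Suc u"] by (auto simp: qpoch_Suc)
    then have "(1 - q ^ Suc u) * (qpoch q s / qpoch q (Suc u)) = qpoch q s / qpoch q u"
      by (simp add: qpoch_Suc del: power_Suc)
    then have "q ^ Suc s * (1 - q ^ Suc u) * (qpoch q s / qpoch q (Suc u)) = q ^ Suc s * (qpoch q s / qpoch q u)"
      by (simp only: mult.assoc)
    then show ?thesis by (simp add: qpoch_Suc algebra_simps diff_divide_distrib)
  qed
  ultimately show ?case by simp
qed

section \<open>Bailey's lemma as an interchange of summation\<close>

lemma has_sum_geometric:
  fixes x :: real
  assumes "0 \<le> x" "x < 1"
  shows "((\<lambda>n. x ^ n) has_sum (1 / (1 - x))) UNIV"
  by (rule sums_nonneg_imp_has_sum) (use assms geometric_sums[of x] in auto)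

lemma summable_on_geometric_product:
  fixes x :: real
  assumes "0 \<le> x" "x < 1"
  shows "(\<lambda>(s, t). c * (x ^ s * x ^ t)) summable_on (UNIV \<times> UNIV)"
proof -
  have "(\<lambda>(s, t). x ^ s * x ^ t) summable_on (UNIV \<times> UNIV)"
  proof (rule summable_on_SigmaI)
    show "((\<lambda>t. (case (s, t) of (s, t) \<Rightarrow> x ^ s * x ^ t)) has_sum (x ^ s * (1 / (1 - x)))) UNIV" for s
      using has_sum_cmult_right[OF has_sum_geometric[OF assms]] by simp
    show "(\<lambda>s. x ^ s * (1 / (1 - x))) summable_on UNIV"
      by (intro summable_on_cmult_left has_sum_imp_summable[OF has_sum_geometric[OF assms]])
  qed (use assms in auto)
  from summable_on_cmult_right[OF this, of c] show ?thesis
    by (simp add: case_prod_unfold)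
qed

text \<open>This is the summand \<open>A n\<close> of the theorem with r as the square root of q; at
  -r it becomes \<open>B n\<close>.\<close>

definition hecke_term :: "complex \<Rightarrow> nat \<Rightarrow> complex" where
  "hecke_term r n = r ^ (2 * n ^ 2 + n) * (1 + r ^ (2 * n + 1)) * theta_sum r n"

text \<open>For \<open>norm q < 1\<close> this is the product of -q^i / (1 + q^i) over 1 <= i <= m.
  The form with \<open>qpoch\<close> displays the factor 1 / (q^2; q^2)_m that
  \<open>bailey_pair\<close> produces.\<close>

definition parts_gf :: "complex \<Rightarrow> nat \<Rightarrow> complex" where
  "parts_gf q m = (-1) ^ m * q ^ tri m * qpoch q m / qpoch (q ^ 2) m"

text \<open>One absolutely convergent double series over (s, t) is summed in two ways: over t for
  fixed s by \<open>phi11_sum\<close>, and along the diagonals s + t = m by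
  \<open>bailey_pair\<close>.\<close>

lemma hecke_sum:
  fixes r :: complex
  assumes "norm r < 1"
  obtains V where "(hecke_term r has_sum V) UNIV"
    and "((\<lambda>m. parts_gf (r ^ 2) m / (1 - r ^ (2 * m + 1))) has_sum V) UNIV"
proof -
  define q where "q = r ^ 2"
  have q: "norm q < 1" using assms by (simp add: q_def norm_power power_less_one_iff)
  note q1 = power_neq_1[OF q]
  define \<alpha> where "\<alpha> s = (-1) ^ s * r ^ (s ^ 2) * (1 + r ^ (2 * s + 1)) * theta_sum r s" for s
  \<comment> \<open>This is (-1)^m q^(tri m) (q)_m \<open>\<alpha> s\<close> / ((q)_(m-s)
    (q)_(m+s+1)) at m = s + t.\<close>
  define f where "f = (\<lambda>(s, t). (-1) ^ (s + t) * q ^ tri (s + t) * qpoch q (s + t) * \<alpha> s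
      / (qpoch q t * qpoch q (2 * s + t + 1)))"
  define K where "K = exp (1 / (1 - norm q))"
  define L where "L = exp (1 / (1 - norm q) ^ 2)"
  define M where "M = 1 + 2 / (1 - norm r)"
  have pos: "0 \<le> K" "0 \<le> L" "0 \<le> M" using assms by (auto simp: K_def L_def M_def)
  have bound_\<alpha>: "norm (\<alpha> s) \<le> 2 * M" for s
  proof -
    have "norm (1 + r ^ (2 * s + 1)) \<le> 1 + norm r ^ (2 * s + 1)"
      by (metis norm_one norm_power norm_triangle_ineq)
    also have "\<dots> \<le> 2" using assms by (simp add: power_le_one mult_le_one)
    finally have "norm r ^ (s ^ 2) * norm (1 + r ^ (2 * s + 1)) * norm (theta_sum r s) \<le> 1 * 2 * M"
      unfolding M_def using assms by (intro mult_mono norm_theta_sum_bounded) (auto simp: power_le_one)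
    then show ?thesis by (simp add: \<alpha>_def norm_mult norm_power)
  qed
  have "f summable_on (UNIV \<times> UNIV)"
  proof (rule abs_summable_summable, rule Infinite_Sum.abs_summable_on_comparison_test')
    show "(\<lambda>(s, t). (K * (2 * M) * (L * L)) * (norm q ^ s * norm q ^ t)) summable_on (UNIV \<times> UNIV)"
      by (rule summable_on_geometric_product) (use q in auto)
  next
    fix p :: "nat \<times> nat"
    obtain s t where p: "p = (s, t)" by (cases p)
    have "norm (f p) = norm q ^ tri (s + t) * norm (qpoch q (s + t)) * norm (\<alpha> s)
        * (norm (inverse (qpoch q t)) * norm (inverse (qpoch q (2 * s + t + 1))))"
      by (simp add: f_def p norm_mult norm_power norm_divide norm_inverse divide_inverse)
    \<comment> \<open>Since s + t <= tri (s + t), the triangular exponent alone supplies geometric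
      decay in both indices; all other factors are bounded.\<close>
    also have "\<dots> \<le> norm q ^ (s + t) * K * (2 * M) * (L * L)"
      unfolding K_def L_def using q le_tri[of "s + t"]
      by (intro mult_mono bound_\<alpha> norm_qpoch_bounded norm_inverse_qpoch_bounded power_decreasing)
         (auto simp: pos)
    finally show "norm (f p) \<le> (case p of (s, t) \<Rightarrow> (K * (2 * M) * (L * L)) * (norm q ^ s * norm q ^ t))"
      by (simp add: p power_add mult_ac)
  qed
  then obtain V where V: "(f has_sum V) (UNIV \<times> UNIV)"
    by (auto simp: summable_on_def)
  have "(hecke_term r has_sum V) UNIV"
  proof (rule has_sum_SigmaD[OF V])
    fix s :: nat
    \<comment> \<open>\<open>phi11_sum\<close> evaluates only the ordered series, so unordered
      summability of the slice is taken from that of f.\<close>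
    have "(\<lambda>t. f (s, t)) summable_on UNIV"
      using summable_on_SigmaD1[of "\<lambda>s t. f (s, t)" UNIV "\<lambda>_. UNIV" s] V by (auto simp: summable_on_def)
    then obtain W where W: "((\<lambda>t. f (s, t)) has_sum W) UNIV" by (auto simp: summable_on_def)
    have nz: "qpoch q s \<noteq> 0" using q1 by (rule qpoch_nonzero)
    \<comment> \<open>The cross term s * t of tri (s + t) supplies the exponent u * t of
      \<open>phi11_sum\<close> with u = s, so the slice sums to (q)_s / (q)_s = 1 up to the
      prefactor.\<close>
    have f_eq: "f (s, t) = (-1) ^ s * q ^ tri s * \<alpha> s *
        ((-1) ^ t * q ^ (tri t + s * t) * qpoch q (s + t) / (qpoch q t * qpoch q (s + s + 1 + t)))" for t
    proof -
      have "2 * s + t + 1 = s + s + 1 + t" by simp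
      then show ?thesis unfolding f_def prod.case by (simp only: tri_add power_add) (simp add: mult_ac)
    qed
    have "(\<lambda>t. f (s, t)) sums ((-1) ^ s * q ^ tri s * \<alpha> s * (qpoch q s / qpoch q s))"
      unfolding f_eq by (intro sums_mult phi11_sum q)
    moreover have "(-1) ^ s * q ^ tri s * \<alpha> s * (qpoch q s / qpoch q s) = hecke_term r s"
    proof -
      have "q ^ tri s = r ^ (s ^ 2 + s)" by (simp add: q_def flip: power_mult two_tri)
      then show ?thesis using nz
        by (simp add: \<alpha>_def hecke_term_def power_add mult_2 mult_ac flip: power_mult_distrib)
    qed
    ultimately have "W = hecke_term r s"
      using has_sum_imp_sums[OF W] sums_unique2 by metis
    with W show "((\<lambda>t. f (s, t)) has_sum hecke_term r s) UNIV" by simp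
  qed
  moreover have "((\<lambda>m. parts_gf q m / (1 - r ^ (2 * m + 1))) has_sum V) UNIV"
  proof (rule has_sum_SigmaD)
    \<comment> \<open>Reindexing by m = s + t turns each diagonal into a finite sum over s <=
      m.\<close>
    show "((\<lambda>(m, s). f (s, m - s)) has_sum V) (Sigma UNIV (\<lambda>m. {..m}))"
      by (rule iffD1[OF has_sum_reindex_bij_witness[where
            i = "\<lambda>(m, s). (s, m - s)" and j = "\<lambda>(s, t). (s + t, s)"] V]) auto
    fix m :: nat
    let ?c = "(-1) ^ m * q ^ tri m * qpoch q m"
    let ?S = "\<Sum>s\<le>m. \<alpha> s / (qpoch q (m - s) * qpoch q (m + s + 1))"
    have "(1 - r ^ (2 * m + 1)) * ?S = 1 / qpoch (q ^ 2) m"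
      unfolding \<alpha>_def q_def by (rule bailey_pair) (use q1 q_def in simp)
    moreover have "1 - r ^ (2 * m + 1) \<noteq> 0" using power_neq_1[OF assms] by force
    ultimately have S: "?S = 1 / qpoch (q ^ 2) m / (1 - r ^ (2 * m + 1))"
      by (metis nonzero_mult_div_cancel_left)
    have "(\<Sum>s\<le>m. f (s, m - s)) = ?c * ?S"
      unfolding sum_distrib_left
    proof (rule sum.cong)
      fix s assume "s \<in> {..m}"
      then have e: "s + (m - s) = m" "2 * s + (m - s) + 1 = m + s + 1" by auto
      show "f (s, m - s) = ?c * (\<alpha> s / (qpoch q (m - s) * qpoch q (m + s + 1)))"
        unfolding f_def prod.case e by simp
    qed simp
    also have "\<dots> = parts_gf q m / (1 - r ^ (2 * m + 1))" unfolding S parts_gf_def by simp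
    finally show "((\<lambda>s. case (m, s) of (m, s) \<Rightarrow> f (s, m - s)) has_sum (parts_gf q m / (1 - r ^ (2 * m + 1)))) {..m}"
      by (intro has_sum_finiteI) simp_all
  qed
  ultimately show ?thesis using that unfolding q_def by blast
qed

section \<open>Distinct partitions weighted by the parity of the largest part\<close>

text \<open>A finite family of distinct partitions lies in some \<open>Pow {1..N}\<close>, over
  which the sum factors as the product of 1 + x^i with x = \<open>norm q\<close>. That product is at
  most exp (1 / (1 - x)), independently of N.\<close>

lemma norm_summable_distinct_partitions:
  fixes q :: complex
  assumes "norm q < 1"
  shows "(\<lambda>\<delta>. norm q ^ \<Sum>\<delta>) summable_on {\<delta>. distinct_partition \<delta>}"
proof (rule nonneg_bdd_above_summable_on)
  let ?x = "norm q"
  have "sum (\<lambda>\<delta>. ?x ^ \<Sum>\<delta>) F \<le> exp (1 / (1 - ?x))"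
    if F: "F \<subseteq> {\<delta>. distinct_partition \<delta>}" "finite F" for F
  proof -
    obtain N where N: "\<Union>F \<subseteq> {..N}"
      using finite_nat_set_iff_bounded_le[of "\<Union>F"] F by (auto simp: distinct_partition_def)
    have "F \<subseteq> Pow {1..N}"
    proof
      fix \<delta> assume "\<delta> \<in> F"
      then have "0 \<notin> \<delta>" "\<delta> \<subseteq> {..N}" using F N by (auto simp: distinct_partition_def)
      then show "\<delta> \<in> Pow {1..N}" by (auto simp: Suc_le_eq intro: gr0I)
    qed
    then have "sum (\<lambda>\<delta>. ?x ^ \<Sum>\<delta>) F \<le> sum (\<lambda>\<delta>. ?x ^ \<Sum>\<delta>) (Pow {1..N})"
      by (intro sum_mono2) auto
    also have "\<dots> = (\<Sum>\<delta>\<in>Pow {1..N}. (\<Prod>i\<in>\<delta>. ?x ^ i) * (\<Prod>i\<in>{1..N} - \<delta>. 1))"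
      by (simp add: power_sum)
    also have "\<dots> = (\<Prod>i=1..N. ?x ^ i + 1)"
      by (rule prod_add[symmetric]) simp
    also have "\<dots> \<le> (\<Prod>i=1..N. exp (?x ^ i))"
      by (intro prod_mono) (auto simp: add.commute[of _ 1] intro: exp_ge_add_one_self)
    also have "\<dots> = exp (\<Sum>i=1..N. ?x ^ i)" by (simp add: exp_sum)
    also have "\<dots> \<le> exp (1 / (1 - ?x))" using sum_power_le assms by simp
    finally show ?thesis .
  qed
  then show "bdd_above (sum (\<lambda>\<delta>. ?x ^ \<Sum>\<delta>) ` {F. F \<subseteq> {\<delta>. distinct_partition \<delta>} \<and> finite F})"
    by (intro bdd_aboveI) auto
qed simp

definition distinct_parts :: "nat \<Rightarrow> nat set set" where
  "distinct_parts m = {\<delta>. distinct_partition \<delta> \<and> card \<delta> = m}"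

lemma distinct_parts_0: "distinct_parts 0 = {{}}"
  by (auto simp: distinct_parts_def distinct_partition_def)

definition wt :: "complex \<Rightarrow> nat set \<Rightarrow> complex" where
  "wt q \<delta> = (-1) ^ largest_part \<delta> * q ^ \<Sum>\<delta>"

lemma largest_part_image_Suc:
  assumes "finite \<delta>" "\<delta> \<noteq> {}"
  shows "largest_part (Suc ` \<delta>) = Suc (largest_part \<delta>)"
  using assms by (simp add: largest_part_def mono_Max_commute[symmetric] mono_def)

lemma sum_image_Suc: "\<Sum>(Suc ` \<delta>) = \<Sum>\<delta> + card \<delta>" if "finite \<delta>" for \<delta> :: "nat set"
  using that by (induction \<delta> rule: finite_induct) (auto simp: inj_image_mem_iff)

lemma wt_image_Suc:
  assumes "\<delta> \<in> distinct_parts (Suc m)"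
  shows "wt q (Suc ` \<delta>) = - (q ^ Suc m) * wt q \<delta>"
proof -
  from assms have "finite \<delta>" "\<delta> \<noteq> {}" "card \<delta> = Suc m"
    by (auto simp: distinct_parts_def distinct_partition_def)
  then show ?thesis
    by (simp add: wt_def largest_part_image_Suc sum_image_Suc power_add)
qed

text \<open>Shifting raises the sum by m and the new part by 1, while the largest part grows by one.
  The convention that the empty partition has largest part 0 makes this hold for the passage from {}
  to {1} as well.\<close>

lemma wt_insert_1:
  assumes "\<delta> \<in> distinct_parts m"
  shows "wt q (insert 1 (Suc ` \<delta>)) = - (q ^ Suc m) * wt q \<delta>"
proof -
  from assms have fin: "finite \<delta>" and card: "card \<delta> = m" and pos: "0 \<notin> \<delta>"
    by (auto simp: distinct_parts_def distinct_partition_def)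
  have "largest_part (insert 1 (Suc ` \<delta>)) = Suc (largest_part \<delta>)"
  proof (cases "\<delta> = {}")
    case False
    then have "Max (insert 1 (Suc ` \<delta>)) = max 1 (Max (Suc ` \<delta>))" using fin by simp
    also have "Max (Suc ` \<delta>) = Suc (Max \<delta>)" using fin False
      by (simp add: mono_Max_commute[symmetric] mono_def)
    finally show ?thesis using False by (simp add: largest_part_def)
  qed (simp add: largest_part_def)
  moreover have "1 \<notin> Suc ` \<delta>" using pos by auto
  then have "\<Sum>(insert 1 (Suc ` \<delta>)) = \<Sum>\<delta> + Suc m"
    using fin card by (simp add: sum_image_Suc)
  ultimately show ?thesis by (simp add: wt_def power_add)
qed

text \<open>Subtracting 1 from every part and dropping a resulting 0 keeps m + 1 parts if 1 is not a
  part and leaves m parts if it is.\<close>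

lemma distinct_parts_Suc: "distinct_parts (Suc m) = (`) Suc ` distinct_parts (Suc m) \<union> (\<lambda>\<delta>. insert 1 (Suc ` \<delta>)) ` distinct_parts m"
proof (intro equalityI subsetI)
  fix \<delta> assume "\<delta> \<in> distinct_parts (Suc m)"
  then have fin: "finite \<delta>" and card: "card \<delta> = Suc m" and pos: "0 \<notin> \<delta>"
    by (auto simp: distinct_parts_def distinct_partition_def)
  define \<epsilon> where "\<epsilon> = (\<lambda>x. x - 1) ` (\<delta> - {1})"
  have S: "Suc ` \<epsilon> = \<delta> - {1}"
  proof -
    have "Suc ` \<epsilon> = (\<lambda>x. Suc (x - 1)) ` (\<delta> - {1})" by (simp add: \<epsilon>_def image_image)
    also have "\<dots> = (\<lambda>x. x) ` (\<delta> - {1})"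
      by (rule image_cong) (use pos in \<open>auto intro: Suc_pred gr0I\<close>)
    finally show ?thesis by simp
  qed
  have "card \<epsilon> = card (\<delta> - {1})" unfolding S[symmetric] by (simp add: card_image)
  moreover have "distinct_partition \<epsilon>"
    unfolding distinct_partition_def
  proof (intro conjI ballI)
    show "finite \<epsilon>" using fin by (simp add: \<epsilon>_def)
    fix x assume "x \<in> \<epsilon>"
    then have "Suc x \<in> \<delta> - {1}" unfolding S[symmetric] by simp
    then show "0 < x" by (cases x) auto
  qed
  ultimately have \<epsilon>: "\<epsilon> \<in> distinct_parts (card (\<delta> - {1}))" by (simp add: distinct_parts_def)
  show "\<delta> \<in> (`) Suc ` distinct_parts (Suc m) \<union> (\<lambda>\<delta>. insert 1 (Suc ` \<delta>)) ` distinct_parts m"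
  proof (cases "1 \<in> \<delta>")
    case True
    then have "\<delta> = insert 1 (Suc ` \<epsilon>)" using S by auto
    moreover have "\<epsilon> \<in> distinct_parts m" using \<epsilon> True fin card by simp
    ultimately show ?thesis by blast
  next
    case False
    then have "\<delta> = Suc ` \<epsilon>" using S by auto
    moreover have "\<epsilon> \<in> distinct_parts (Suc m)" using \<epsilon> False card by simp
    ultimately show ?thesis by blast
  qed
next
  fix \<delta> assume "\<delta> \<in> (`) Suc ` distinct_parts (Suc m) \<union> (\<lambda>\<delta>. insert 1 (Suc ` \<delta>)) ` distinct_parts m"
  then show "\<delta> \<in> distinct_parts (Suc m)"
  proof (elim UnE imageE)
    fix \<epsilon> assume e: "\<delta> = Suc ` \<epsilon>" "\<epsilon> \<in> distinct_parts (Suc m)"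
    then show ?thesis by (auto simp: distinct_parts_def distinct_partition_def card_image)
  next
    fix \<epsilon> assume e: "\<delta> = insert 1 (Suc ` \<epsilon>)" "\<epsilon> \<in> distinct_parts m"
    then have "1 \<notin> Suc ` \<epsilon>" by (auto simp: distinct_parts_def distinct_partition_def)
    with e show ?thesis by (auto simp: distinct_parts_def distinct_partition_def card_image)
  qed
qed

text \<open>Let S be the sum for m + 1 parts. The decomposition \<open>distinct_parts_Suc\<close>
  gives S = -q^(m+1) S - q^(m+1) \<open>parts_gf q m\<close>, because the partitions without a part
  1 are a shifted copy of the whole class. Solving for S gives the factor -q^(m+1) / (1 +
  q^(m+1)).\<close>

lemma wt_has_sum_distinct_parts:
  assumes q: "norm q < 1"
  shows "(wt q has_sum parts_gf q m) (distinct_parts m)"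
proof (induction m)
  case 0
  show ?case unfolding distinct_parts_0 by (rule has_sum_finiteI) (simp_all add: parts_gf_def wt_def largest_part_def)
next
  case (Suc m)
  \<comment> \<open>S occurs on both sides of the recurrence, so its existence has to be secured
    first.\<close>
  have "wt q summable_on distinct_parts (Suc m)"
  proof (rule abs_summable_summable, rule Infinite_Sum.abs_summable_on_comparison_test')
    show "(\<lambda>\<delta>. norm q ^ \<Sum>\<delta>) summable_on distinct_parts (Suc m)"
      by (rule summable_on_subset_banach[OF norm_summable_distinct_partitions[OF q]]) (auto simp: distinct_parts_def)
  qed (simp add: wt_def norm_mult norm_power)
  then obtain S where S: "(wt q has_sum S) (distinct_parts (Suc m))" by (auto simp: summable_on_def)
  have "(wt q has_sum (- (q ^ Suc m) * S)) ((`) Suc ` distinct_parts (Suc m))"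
  proof (subst has_sum_reindex)
    show "inj_on ((`) Suc) (distinct_parts (Suc m))" by (meson inj_Suc inj_image_eq_iff inj_onI)
    show "(wt q \<circ> (`) Suc has_sum - (q ^ Suc m) * S) (distinct_parts (Suc m))"
      using has_sum_cmult_right[OF S]
      by (subst has_sum_cong[where g = "\<lambda>\<delta>. - (q ^ Suc m) * wt q \<delta>"]) (simp_all only: o_apply wt_image_Suc)
  qed
  moreover have "(wt q has_sum (- (q ^ Suc m) * parts_gf q m)) ((\<lambda>\<delta>. insert 1 (Suc ` \<delta>)) ` distinct_parts m)"
  proof (subst has_sum_reindex)
    have "insert 1 (Suc ` \<delta>) - {1} = Suc ` \<delta>" if "\<delta> \<in> distinct_parts m" for \<delta>
      using that by (auto simp: distinct_parts_def distinct_partition_def)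
    then show "inj_on (\<lambda>\<delta>. insert 1 (Suc ` \<delta>)) (distinct_parts m)"
      by (metis (mono_tags, lifting) inj_Suc inj_image_eq_iff inj_onI)
    show "(wt q \<circ> (\<lambda>\<delta>. insert 1 (Suc ` \<delta>)) has_sum - (q ^ Suc m) * parts_gf q m) (distinct_parts m)"
      using has_sum_cmult_right[OF Suc]
      by (subst has_sum_cong[where g = "\<lambda>\<delta>. - (q ^ Suc m) * wt q \<delta>"]) (simp_all only: o_apply wt_insert_1)
  qed
  moreover have "(`) Suc ` distinct_parts (Suc m) \<inter> (\<lambda>\<delta>. insert 1 (Suc ` \<delta>)) ` distinct_parts m = {}"
  proof -
    have "1 \<notin> Suc ` \<delta>" if "\<delta> \<in> distinct_parts (Suc m)" for \<delta>
      using that by (auto simp: distinct_parts_def distinct_partition_def)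
    then show ?thesis by blast
  qed
  ultimately have "(wt q has_sum (- (q ^ Suc m) * S + - (q ^ Suc m) * parts_gf q m)) (distinct_parts (Suc m))"
    by (subst distinct_parts_Suc) (rule has_sum_Un_disjoint)
  with S have rec: "S = - (q ^ Suc m) * S + - (q ^ Suc m) * parts_gf q m" by (rule has_sum_unique)
  have "norm (q ^ Suc m) \<noteq> 1"
    using power_less_one_iff[of "norm q" "Suc m"] q by (auto simp: norm_power norm_mult)
  then have nz: "1 + q ^ Suc m \<noteq> 0" by (metis add.inverse_unique norm_minus_cancel norm_one)
  have nz': "1 - q ^ Suc m \<noteq> 0" using power_neq_1[OF q] by (metis eq_iff_diff_eq_0 zero_less_Suc)
  have "S * (1 + q ^ Suc m) = - (q ^ Suc m) * parts_gf q m"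
  proof -
    have "S * (1 + q ^ Suc m) - - (q ^ Suc m) * parts_gf q m = S - (- (q ^ Suc m) * S + - (q ^ Suc m) * parts_gf q m)"
      by (simp add: algebra_simps)
    also have "\<dots> = 0" by (subst right_minus_eq) (rule rec)
    finally show ?thesis by (simp only: right_minus_eq)
  qed
  then have "S = - (q ^ Suc m) * parts_gf q m / (1 + q ^ Suc m)" using nz by (metis nonzero_mult_div_cancel_right)
  also have "\<dots> = parts_gf q (Suc m)"
  proof -
    have "1 - (q ^ 2) ^ Suc m = (1 - q ^ Suc m) * (1 + q ^ Suc m)"
      by (simp add: algebra_simps power2_eq_square power_mult_distrib)
    then have "(1 - q ^ Suc m) / (1 - (q ^ 2) ^ Suc m) = 1 / (1 + q ^ Suc m)"
      using nz nz' by simp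
    moreover have "parts_gf q (Suc m) = - (q ^ Suc m) * parts_gf q m * ((1 - q ^ Suc m) / (1 - (q ^ 2) ^ Suc m))"
      by (simp add: parts_gf_def qpoch_Suc power_add mult_ac)
    ultimately show ?thesis by simp
  qed
  finally show ?case using S by simp
qed

section \<open>The left-hand side as a single series\<close>

text \<open>The sum over all pairs (\<delta>, k) converges absolutely and is grouped in two ways:
  into the finite sets \<open>P_pairs m j n\<close>, and by m alone, where k contributes a geometric
  series in q^(2m+1).\<close>

lemma partition_pairs_has_sum:
  assumes q: "norm q < 1"
  obtains S where "((\<lambda>(m, n, j). (-1) ^ j * of_nat (P m j n) * q ^ n) has_sum S) UNIV"
    and "((\<lambda>m. parts_gf q m / (1 - q ^ (2 * m + 1))) has_sum S) UNIV"
proof -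
  define f where "f = (\<lambda>(\<delta>, k). wt q \<delta> * q ^ (k * (2 * card \<delta> + 1)))"
  let ?DP = "{\<delta>. distinct_partition \<delta>}"
  have "f summable_on (?DP \<times> UNIV)"
  proof (rule abs_summable_summable, rule Infinite_Sum.abs_summable_on_comparison_test')
    show "(\<lambda>(\<delta>, k). norm q ^ \<Sum>\<delta> * norm q ^ k) summable_on (?DP \<times> UNIV)"
    proof (rule summable_on_SigmaI)
      show "((\<lambda>k. case (\<delta>, k) of (\<delta>, k) \<Rightarrow> norm q ^ \<Sum>\<delta> * norm q ^ k) has_sum
          (norm q ^ \<Sum>\<delta> * (1 / (1 - norm q)))) UNIV" for \<delta>
        using has_sum_cmult_right[OF has_sum_geometric] q by simp
      show "(\<lambda>\<delta>. norm q ^ \<Sum>\<delta> * (1 / (1 - norm q))) summable_on ?DP"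
        by (intro summable_on_cmult_left norm_summable_distinct_partitions q)
    qed auto
    fix p :: "nat set \<times> nat"
    obtain \<delta> k where p: "p = (\<delta>, k)" by (cases p)
    have "norm (f p) = norm q ^ \<Sum>\<delta> * norm q ^ (k * (2 * card \<delta> + 1))"
      by (simp add: f_def p wt_def norm_mult norm_power)
    also have "\<dots> \<le> norm q ^ \<Sum>\<delta> * norm q ^ k"
      using q by (intro mult_left_mono power_decreasing) auto
    finally show "norm (f p) \<le> (case p of (\<delta>, k) \<Rightarrow> norm q ^ \<Sum>\<delta> * norm q ^ k)"
      by (simp add: p)
  qed
  then obtain S where S: "(f has_sum S) (?DP \<times> UNIV)" by (auto simp: summable_on_def)
  have "((\<lambda>(m, n, j). (-1) ^ j * of_nat (P m j n) * q ^ n) has_sum S) UNIV"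
  proof (rule has_sum_SigmaD)
    \<comment> \<open>A pair determines its triple (m, n, j), so the sets
      \<open>P_pairs m j n\<close> partition the index set.\<close>
    show "((\<lambda>(x, p). f p) has_sum S) (Sigma UNIV (\<lambda>(m, n, j). P_pairs m j n))"
      by (rule iffD1[OF has_sum_reindex_bij_witness[where i = snd and
           j = "\<lambda>(\<delta>, k). ((card \<delta>, \<Sum>\<delta> + k * (2 * card \<delta> + 1), largest_part \<delta>), (\<delta>, k))"] S])
         (auto simp: P_pairs_def)
    fix x :: "nat \<times> nat \<times> nat"
    obtain m n j where x: "x = (m, n, j)" by (cases x)
    have "f p = (-1) ^ j * q ^ n" if "p \<in> P_pairs m j n" for p
      using that by (auto simp: P_pairs_def f_def wt_def power_add)
    then have "sum f (P_pairs m j n) = (-1) ^ j * of_nat (P m j n) * q ^ n"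
      by (simp add: P_def)
    then show "((\<lambda>p. case (x, p) of (x, p) \<Rightarrow> f p) has_sum
        (case x of (m, n, j) \<Rightarrow> (-1) ^ j * of_nat (P m j n) * q ^ n)) (case x of (m, n, j) \<Rightarrow> P_pairs m j n)"
      by (simp add: x has_sum_finiteI finite_P_pairs)
  qed
  moreover have "((\<lambda>m. parts_gf q m / (1 - q ^ (2 * m + 1))) has_sum S) UNIV"
  proof (rule has_sum_SigmaD)
    show "((\<lambda>(m, p). f p) has_sum S) (Sigma UNIV (\<lambda>m. distinct_parts m \<times> UNIV))"
      by (rule iffD1[OF has_sum_reindex_bij_witness[where i = snd and
           j = "\<lambda>(\<delta>, k). (card \<delta>, (\<delta>, k))"] S]) (auto simp: distinct_parts_def)
    fix m :: nat
    have "f summable_on (distinct_parts m \<times> UNIV)"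
      by (rule summable_on_subset_banach[of _ "?DP \<times> UNIV"])
         (use S in \<open>auto simp: distinct_parts_def summable_on_def\<close>)
    moreover have "((\<lambda>k. f (\<delta>, k)) has_sum (wt q \<delta> * (1 / (1 - q ^ (2 * m + 1))))) UNIV" if "\<delta> \<in> distinct_parts m" for \<delta>
    proof -
      let ?y = "q ^ (2 * m + 1)"
      have "norm ?y < 1"
        unfolding norm_power using q by (subst power_less_one_iff) auto
      then have "((\<lambda>k. ?y ^ k) has_sum (1 / (1 - ?y))) UNIV"
        by (intro norm_summable_imp_has_sum geometric_sums) (simp_all add: norm_power)
      moreover have "f (\<delta>, k) = wt q \<delta> * ?y ^ k" for k
        using that unfolding power_mult[symmetric] by (simp add: f_def distinct_parts_def mult.commute)
      ultimately show ?thesis by (simp only: has_sum_cmult_right)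
    qed
    moreover have "((\<lambda>\<delta>. wt q \<delta> * (1 / (1 - q ^ (2 * m + 1)))) has_sum
        (parts_gf q m * (1 / (1 - q ^ (2 * m + 1))))) (distinct_parts m)"
      by (rule has_sum_cmult_left[OF wt_has_sum_distinct_parts[OF q]])
    ultimately have "(f has_sum (parts_gf q m * (1 / (1 - q ^ (2 * m + 1))))) (distinct_parts m \<times> UNIV)"
      by (intro has_sum_SigmaI)
    then show "((\<lambda>p. case (m, p) of (m, p) \<Rightarrow> f p) has_sum (parts_gf q m / (1 - q ^ (2 * m + 1)))) (distinct_parts m \<times> UNIV)"
      by simp
  qed
  ultimately show ?thesis using that by blast
qed

section \<open>Even part in r and conclusion\<close>

text \<open>Only parities matter: j^2 has the parity of j, 2n^2 + n that of n, and 2n + 1 is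
  odd.\<close>

lemma hecke_term_minus:
  "hecke_term (- r) n = (-1) ^ n * r ^ (2 * n ^ 2 + n) * (1 - r ^ (2 * n + 1)) *
      (\<Sum>j\<in>{- int n..int n}. (-1) powi j * r powi (j ^ 2))"
proof -
  have "(- r) powi (j ^ 2) = (-1) powi j * r powi (j ^ 2)" for j :: int
  proof -
    have "(- r) powi (j ^ 2) = (-1) powi (j ^ 2) * r powi (j ^ 2)"
      using power_int_mult_distrib[of "-1" r "j ^ 2"] by simp
    also have "(-1 :: complex) powi (j ^ 2) = (-1) powi j"
      by (cases "even j") (simp_all add: power_int_minus_left)
    finally show ?thesis .
  qed
  moreover have "(- r) ^ (2 * n ^ 2 + n) = (-1) ^ n * r ^ (2 * n ^ 2 + n)"
    by (subst power_minus) (simp add: power_add)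
  ultimately show ?thesis by (simp add: hecke_term_def theta_sum_def)
qed

theorem theorem1p1:
  fixes q r :: complex
  assumes "0 < norm q" and "norm q < 1"
    and "r ^ 2 = q"
  shows "let A = (\<lambda>n::nat. r ^ (2 * n ^ 2 + n) * (1 + r ^ (2 * n + 1)) *
                   (\<Sum>j\<in>{- int n..int n}. r powi (j ^ 2)));
             B = (\<lambda>n::nat. (-1) ^ n * r ^ (2 * n ^ 2 + n) * (1 - r ^ (2 * n + 1)) *
                   (\<Sum>j\<in>{- int n..int n}. (-1) powi j * r powi (j ^ 2)))
         in summable A \<and> summable B \<and>
            ((\<lambda>(m, n, j). (-1) ^ j * of_nat (P m j n) * q ^ n) has_sum
               (1 / 2 * (\<Sum>n. A n) + 1 / 2 * (\<Sum>n. B n))) (UNIV :: (nat \<times> nat \<times> nat) set)"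
proof -
  have r: "norm r < 1"
    using assms(2) power_less_one_iff[of "norm r" 2] by (simp add: assms(3)[symmetric] norm_power)
  obtain V where V: "(hecke_term r has_sum V) UNIV"
      "((\<lambda>m. parts_gf q m / (1 - r ^ (2 * m + 1))) has_sum V) UNIV"
    using hecke_sum[OF r] unfolding assms(3) by blast
  \<comment> \<open>Passing to -r leaves q = r^2 and hence \<open>parts_gf q m\<close> unchanged and
    only flips the sign in the denominator.\<close>
  have "(- r) ^ (2 * m + 1) = - (r ^ (2 * m + 1))" for m by simp
  then obtain W where W: "(hecke_term (- r) has_sum W) UNIV"
      "((\<lambda>m. parts_gf q m / (1 + r ^ (2 * m + 1))) has_sum W) UNIV"
    using hecke_sum[of "- r"] r by (auto simp: assms(3))
  obtain S where S: "((\<lambda>(m, n, j). (-1) ^ j * of_nat (P m j n) * q ^ n) has_sum S) UNIV"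
      "((\<lambda>m. parts_gf q m / (1 - q ^ (2 * m + 1))) has_sum S) UNIV"
    using partition_pairs_has_sum[OF assms(2)] by blast
  \<comment> \<open>Partial fractions 1/(1-x) + 1/(1+x) = 2/(1-x^2) at x = r^(2m+1), where x^2 =
    q^(2m+1).\<close>
  have "1 / 2 * (parts_gf q m / (1 - r ^ (2 * m + 1))) + 1 / 2 * (parts_gf q m / (1 + r ^ (2 * m + 1)))
      = parts_gf q m / (1 - q ^ (2 * m + 1))" for m
  proof -
    let ?x = "r ^ (2 * m + 1)"
    have "norm ?x < 1" unfolding norm_power using r by (subst power_less_one_iff) auto
    then have "?x \<noteq> 1" "?x \<noteq> - 1" by auto
    then have nz: "1 - ?x \<noteq> 0" "1 + ?x \<noteq> 0" by (auto simp only: add_eq_0_iff right_minus_eq)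
    have "q ^ (2 * m + 1) = ?x * ?x"
      by (simp add: assms(3)[symmetric] power_mult_distrib power2_eq_square)
    then have q_eq: "1 - q ^ (2 * m + 1) = (1 - ?x) * (1 + ?x)" by (simp add: algebra_simps)
    have "1 / 2 * (e / a) + 1 / 2 * (e / b) = e / (a * b)"
      if "a \<noteq> 0" "b \<noteq> 0" "a + b = 2" for a b e :: complex
    proof -
      have "1 / 2 * (e / a) + 1 / 2 * (e / b) = e * ((a + b) / 2) / (a * b)"
        using that(1,2) by (simp add: add_divide_distrib distrib_left)
      then show ?thesis using that(3) by simp
    qed
    from this[OF nz] show ?thesis unfolding q_eq by simp
  qed
  then have "((\<lambda>m. parts_gf q m / (1 - q ^ (2 * m + 1))) has_sum (1 / 2 * V + 1 / 2 * W)) UNIV"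
    using has_sum_add[OF has_sum_cmult_right[OF V(2), of "1 / 2"] has_sum_cmult_right[OF W(2), of "1 / 2"]]
    by (simp only:)
  with S(2) have "S = 1 / 2 * V + 1 / 2 * W" by (rule has_sum_unique)
  with S(1) has_sum_imp_sums[OF V(1)] has_sum_imp_sums[OF W(1)] show ?thesis
    unfolding Let_def hecke_term_minus[symmetric]
    by (simp add: hecke_term_def[abs_def] theta_sum_def sums_iff)
qed

end
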